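(* Let $H\colon\mathbb{R}^n\to\mathbb{R}^n$ be continuous and let $\bar x\in\mathbb{R}^n$ be a solution of $H(x)=0$. Suppose that $H$ is metrically regular around $\bar x$ and that the following two assumptions hold. (H1) There exist a constant $C>0$, a neighborhood $U$ of $\bar x$, and a neighborhood $V$ of the origin in $\mathbb{R}^n$ such that: for all $x\in U$, $z\in V$, and for any $d\in\mathbb{R}^n$ with $-H(x)\in DH(x)(d)$ there is a vector $w\in\tilde DH(x)(z)$ such that $$C\|d-z\|\le\|w+H(x)\|+o(\|x-\bar x\|).$$ (H2) There exists a neighborhood $U$ of $\bar x$ such that for all $x\in U$ and all $v\in\tilde DH(x)(\bar x-x)$ we have $$\|H(x)-H(\bar x)+v\|=o(\|x-\bar x\|).$$ Then there is a number $\varepsilon>0$ such that for all $x^0\in B_\varepsilon(\bar x)$ the following assertions hold: (i) The generalized Newton algorithm started at $x^0$ is well defined and generates a sequence $\{x^k\}$ converging to $\bar x$. (ii) The rate of convergence $x^k\to\bar x$ is at least superlinear, i.e., $\|x^{k+1}-\bar x\|=o(\|x^k-\bar x\|)$ as $k\to\infty$.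
   Context: Generalized Newton algorithm: given $x^0\in\mathbb{R}^n$, for $k=0,1,2,\ldots$ compute $d^k\in\mathbb{R}^n$ with $-H(x^k)\in DH(x^k)(d^k)$ (any solution) and set $x^{k+1}:=x^k+d^k$ (the termination test is disregarded). "Well defined" means that the inclusion for $d^k$ is solvable at each iterate. $B_\varepsilon(\bar x)$ is the closed Euclidean ball of radius $\varepsilon$ centered at $\bar x$. Metric regularity: $H$ is metrically regular around $\bar x$ if there are neighborhoods $U$ of $\bar x$ and $V$ of $H(\bar x)$ and $\mu>0$ such that $\mathrm{dist}(x;H^{-1}(y))\le\mu\|y-H(x)\|$ for all $x\in U$, $y\in V$ (with $\mathrm{dist}(x;\emptyset)=\infty$). Graphical derivative: $DH(x)(z)$ is the set of $w$ such that there are $t_k\downarrow0$, $h_k\to z$ with $(H(x+t_kh_k)-H(x))/t_k\to w$; equivalently $(z,w)$ lies in the Bouligand tangent cone to the graph of $H$ at $(x,H(x))$. Restrictive graphical derivative: $\tilde DH(x)(z)$ is the set of $w$ such that there are $t_k\downarrow0$ with $(H(x+t_kz)-H(x))/t_k\to w$. In (H1) and (H2), $o(\|x-\bar x\|)$ denotes a quantity bounded in absolute value by $\rho(\|x-\bar x\|)$, where $\rho\colon[0,\infty)\to[0,\infty)$, $\rho(0)=0$, $\rho(s)/s\to0$ as $s\downarrow0$, and $\rho$ does not depend on $z,d,w,v$. *)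

theory Defs
  imports "HOL-Analysis.Analysis" "HOL-Library.Landau_Symbols"
begin

(* The library's infdist has infdist x {} = 0, whereas metric regularity needs the
   convention dist(x; {}) = \<infinity>, which the infimum over the extended reals provides. *)
definition ext_dist :: "'a::metric_space \<Rightarrow> 'a set \<Rightarrow> ereal" where
  "ext_dist x A = (INF a\<in>A. ereal (dist x a))"

(* Neighborhoods of a point are sets having that point in their interior. *)
definition metrically_regular_around ::
    "('a::real_normed_vector \<Rightarrow> 'b::real_normed_vector) \<Rightarrow> 'a \<Rightarrow> bool" where
  "metrically_regular_around H xbar \<longleftrightarrow>
     (\<exists>U V \<mu>. xbar \<in> interior U \<and> H xbar \<in> interior V \<and> 0 < \<mu> \<and>
        (\<forall>x\<in>U. \<forall>y\<in>V. ext_dist x (H -` {y}) \<le> ereal (\<mu> * norm (y - H x))))"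

definition graphical_derivative ::
    "('a::real_normed_vector \<Rightarrow> 'b::real_normed_vector) \<Rightarrow> 'a \<Rightarrow> 'a \<Rightarrow> 'b set" where
  "graphical_derivative H x z =
     {w. \<exists>(t :: nat \<Rightarrow> real) h. (\<forall>k. 0 < t k) \<and> t \<longlonglongrightarrow> 0 \<and> h \<longlonglongrightarrow> z \<and>
           (\<lambda>k. (H (x + t k *\<^sub>R h k) - H x) /\<^sub>R t k) \<longlonglongrightarrow> w}"

definition restrictive_graphical_derivative ::
    "('a::real_normed_vector \<Rightarrow> 'b::real_normed_vector) \<Rightarrow> 'a \<Rightarrow> 'a \<Rightarrow> 'b set" where
  "restrictive_graphical_derivative H x z =
     {w. \<exists>t :: nat \<Rightarrow> real. (\<forall>k. 0 < t k) \<and> t \<longlonglongrightarrow> 0 \<and>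
           (\<lambda>k. (H (x + t k *\<^sub>R z) - H x) /\<^sub>R t k) \<longlonglongrightarrow> w}"

(* A quantity is o(s), uniformly in all other parameters, if it is bounded in absolute value
   by \<rho> s for some such \<rho>. Values of \<rho> at negative arguments are irrelevant. *)
definition little_o_modulus :: "(real \<Rightarrow> real) \<Rightarrow> bool" where
  "little_o_modulus \<rho> \<longleftrightarrow>
     (\<forall>s\<ge>0. 0 \<le> \<rho> s) \<and> \<rho> 0 = 0 \<and> ((\<lambda>s. \<rho> s / s) \<longlongrightarrow> 0) (at_right 0)"

definition newton_direction ::
    "('a::real_normed_vector \<Rightarrow> 'a) \<Rightarrow> 'a \<Rightarrow> 'a \<Rightarrow> bool" where
  "newton_direction H x d \<longleftrightarrow> - H x \<in> graphical_derivative H x d"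

definition newton_step ::
    "('a::real_normed_vector \<Rightarrow> 'a) \<Rightarrow> 'a \<Rightarrow> 'a \<Rightarrow> bool" where
  "newton_step H x y \<longleftrightarrow> (\<exists>d. newton_direction H x d \<and> y = x + d)"

(* Directions may be chosen arbitrarily, so the possible iterates of the algorithm started
   at x0 are all points reachable from x0 by finitely many steps. *)
definition newton_well_defined ::
    "('a::real_normed_vector \<Rightarrow> 'a) \<Rightarrow> 'a \<Rightarrow> bool" where
  "newton_well_defined H x0 \<longleftrightarrow>
     (\<forall>x. (newton_step H)\<^sup>*\<^sup>* x0 x \<longrightarrow> (\<exists>d. newton_direction H x d))"

definition newton_sequence ::
    "('a::real_normed_vector \<Rightarrow> 'a) \<Rightarrow> 'a \<Rightarrow> (nat \<Rightarrow> 'a) \<Rightarrow> bool" where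
  "newton_sequence H x0 x \<longleftrightarrow> x 0 = x0 \<and> (\<forall>k. newton_step H (x k) (x (Suc k)))"

end

theory Submission
  imports Defs
begin

text \<open>
  Near \<open>xbar\<close> two things happen.

  Solvability comes from metric regularity: it lets one solve \<open>H a = H x + t *\<^sub>R w\<close> with
  \<open>a\<close> at distance \<open>O(t)\<close> from \<open>x\<close>, so the difference quotients \<open>(a - x) /\<^sub>R t\<close> stay bounded
  as \<open>t \<down> 0\<close>, and every cluster point \<open>d\<close> of them satisfies \<open>w \<in> graphical_derivative H x d\<close>
  (\<open>metrically_regular_imp_graphical_derivative_surj\<close>). The choice \<open>w = - H x\<close> is the Newton
  inclusion.

  Contraction comes from testing (H1) with the ideal direction \<open>z = xbar - x\<close>, the one that hits
  the solution in a single step. Since \<open>d - z\<close> is then the error \<open>x + d - xbar\<close> of the next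
  iterate, and (H2) says that the residual \<open>w + H x\<close> is negligible for this \<open>z\<close>, any Newton step
  shrinks the error by an arbitrarily small factor as \<open>x\<close> approaches \<open>xbar\<close>
  (\<open>newton_step_error_small\<close>). The factor \<open>1 / 2\<close> on a ball keeps all
  iterates there and forces convergence; small factors then give the superlinear rate.
\<close>

text \<open>At \<open>x = a\<close> the quotient \<open>\<rho> s / s\<close> carries no information; there the bound rests on
  \<open>\<rho> 0 = 0\<close>, so the estimate holds on a full neighborhood instead of a punctured one.\<close>

lemma little_o_modulus_eventually_le:
  fixes a :: "'a::real_normed_vector"
  assumes "little_o_modulus \<rho>" and "0 < c"
  shows "\<forall>\<^sub>F x in nhds a. \<rho> (norm (x - a)) \<le> c * norm (x - a)"
proof -
  have "((\<lambda>s. \<rho> s / s) \<longlongrightarrow> 0) (at_right 0)" and zero: "\<rho> 0 = 0"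
    using assms(1) by (auto simp: little_o_modulus_def)
  then have "\<forall>\<^sub>F s in at_right 0. \<rho> s / s < c"
    using order_tendstoD(2) assms(2) by blast
  then obtain b where b: "b > 0" "\<And>s. 0 < s \<Longrightarrow> s < b \<Longrightarrow> \<rho> s / s < c"
    by (auto simp: eventually_at_right_field)
  have "\<rho> (norm (x - a)) \<le> c * norm (x - a)" if "dist x a < b" for x
  proof (cases "x = a")
    case False
    then show ?thesis
      using b(2)[of "norm (x - a)"] that by (simp add: dist_norm field_simps)
  qed (simp add: zero)
  with b(1) show ?thesis
    unfolding eventually_nhds_metric by blast
qed

text \<open>The solutions of \<open>H a = H x + t *\<^sub>R w\<close> are only nearly closest to \<open>x\<close>, since the infimum
  defining the distance need not be attained; the slack \<open>t\<close> in the bound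
  \<open>dist x a < (\<mu> * norm w + 1) * t\<close> covers this and is also what makes the inequality
  strict when \<open>w = 0\<close>. Finite dimension of the domain supplies the cluster point.\<close>

lemma metrically_regular_imp_graphical_derivative_surj:
  fixes H :: "'a::euclidean_space \<Rightarrow> 'b::real_normed_vector"
  assumes "metrically_regular_around H xbar" and "isCont H xbar"
  shows "\<forall>\<^sub>F x in nhds xbar. \<forall>w. \<exists>d. w \<in> graphical_derivative H x d"
proof -
  obtain U V \<mu> where UV: "xbar \<in> interior U" "H xbar \<in> interior V" "0 < \<mu>"
    and reg: "\<And>x y. x \<in> U \<Longrightarrow> y \<in> V \<Longrightarrow> ext_dist x (H -` {y}) \<le> ereal (\<mu> * norm (y - H x))"
    using assms(1) unfolding metrically_regular_around_def by blast
  have "\<forall>\<^sub>F x in nhds xbar. x \<in> interior U"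
    using UV(1) by (simp add: eventually_nhds_in_open)
  moreover have "\<forall>\<^sub>F x in nhds xbar. H x \<in> interior V"
    using topological_tendstoD[OF _ open_interior UV(2)] assms(2)
    by (simp add: isCont_def tendsto_at_iff_tendsto_nhds)
  ultimately show ?thesis
  proof eventually_elim
    case (elim x)
    show ?case
    proof
      fix w :: 'b
      define t :: "nat \<Rightarrow> real" where "t k = inverse (real (Suc k))" for k
      have t: "0 < t k" for k by (simp add: t_def)
      have t0: "t \<longlonglongrightarrow> 0"
        unfolding t_def by (rule LIMSEQ_inverse_real_of_nat)
      have "(\<lambda>k. H x + t k *\<^sub>R w) \<longlonglongrightarrow> H x + 0 *\<^sub>R w"
        by (intro tendsto_intros t0)
      then have "\<forall>\<^sub>F k in sequentially. H x + t k *\<^sub>R w \<in> interior V"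
        using topological_tendstoD[OF _ open_interior, of _ "H x + 0 *\<^sub>R w"] elim(2) by simp
      then obtain N where N: "\<And>k. k \<ge> N \<Longrightarrow> H x + t k *\<^sub>R w \<in> V"
        using interior_subset by (auto simp: eventually_sequentially)
      define B where "B = \<mu> * norm w + 1"
      have "\<exists>a. H a = H x + t k *\<^sub>R w \<and> dist x a < B * t k" if "k \<ge> N" for k
      proof -
        have "ext_dist x (H -` {H x + t k *\<^sub>R w}) \<le> ereal (\<mu> * norm (t k *\<^sub>R w))"
          using reg[of x "H x + t k *\<^sub>R w"] N[OF that] elim(1) interior_subset by auto
        also have "\<dots> < ereal (B * t k)"
          using t[of k] by (simp add: B_def algebra_simps)
        finally show ?thesis
          by (auto simp: ext_dist_def INF_less_iff)
      qed
      then have "\<exists>a. H a = H x + t (k + N) *\<^sub>R w \<and> dist x a < B * t (k + N)" for k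
        by simp
      then obtain a where a: "\<And>k. H (a k) = H x + t (k + N) *\<^sub>R w"
          "\<And>k. dist x (a k) < B * t (k + N)"
        by metis
      define h where "h k = (a k - x) /\<^sub>R t (k + N)" for k
      have "h k \<in> cball 0 B" for k
        using a(2)[of k] t[of "k + N"]
        by (simp add: h_def dist_norm norm_minus_commute pos_divide_le_eq divide_inverse_commute[symmetric])
      then obtain d r where r: "strict_mono r" and "(h \<circ> r) \<longlonglongrightarrow> d"
        using compact_cball[of "0::'a" B] unfolding compact_def by metis
      moreover have "(\<lambda>k. t (r k + N)) \<longlonglongrightarrow> 0"
        using LIMSEQ_subseq_LIMSEQ[OF LIMSEQ_ignore_initial_segment[OF t0, of N] r]
        by (simp add: o_def)
      moreover have "(H (x + t (k + N) *\<^sub>R h k) - H x) /\<^sub>R t (k + N) = w" for k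
        using t[of "k + N"] by (simp add: h_def a(1))
      ultimately show "\<exists>d. w \<in> graphical_derivative H x d"
        unfolding graphical_derivative_def using t
        by (intro exI[of _ d] CollectI exI[of _ "\<lambda>k. t (r k + N)"] exI[of _ "h \<circ> r"]) simp
    qed
  qed
qed

text \<open>With \<open>z = xbar - x\<close>, the hypothesis (H1) bounds \<open>C\<close> times the new error by the residual
  \<open>norm (w + H x)\<close> plus its modulus, and (H2) bounds that residual by a second modulus. The new
  error is thus at most the sum of the two moduli divided by \<open>C\<close>, so it suffices to make each
  modulus at most \<open>C * c / 2\<close> times the old error.\<close>

lemma newton_step_error_small:
  fixes H :: "'a::real_normed_vector \<Rightarrow> 'a"
  assumes "H xbar = 0"
    and H1: "\<exists>C>0. \<exists>U V \<rho>. xbar \<in> interior U \<and> 0 \<in> interior V \<and> little_o_modulus \<rho> \<and>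
          (\<forall>x\<in>U. \<forall>z\<in>V. \<forall>d. - H x \<in> graphical_derivative H x d \<longrightarrow>
             (\<exists>w \<in> restrictive_graphical_derivative H x z.
                C * norm (d - z) \<le> norm (w + H x) + \<rho> (norm (x - xbar))))"
    and H2: "\<exists>U \<rho>. xbar \<in> interior U \<and> little_o_modulus \<rho> \<and>
          (\<forall>x\<in>U. \<forall>v \<in> restrictive_graphical_derivative H x (xbar - x).
             norm (H x - H xbar + v) \<le> \<rho> (norm (x - xbar)))"
    and "0 < c"
  shows "\<forall>\<^sub>F x in nhds xbar. \<forall>y. newton_step H x y \<longrightarrow> norm (y - xbar) \<le> c * norm (x - xbar)"
proof -
  obtain C U1 V \<rho>1 where C: "C > 0" and nbhd1: "xbar \<in> interior U1" "0 \<in> interior V"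
    and \<rho>1: "little_o_modulus \<rho>1"
    and est1: "\<And>x z d. x \<in> U1 \<Longrightarrow> z \<in> V \<Longrightarrow> - H x \<in> graphical_derivative H x d \<Longrightarrow>
             \<exists>w \<in> restrictive_graphical_derivative H x z.
                C * norm (d - z) \<le> norm (w + H x) + \<rho>1 (norm (x - xbar))"
    using H1 by metis
  obtain U2 \<rho>2 where nbhd2: "xbar \<in> interior U2" and \<rho>2: "little_o_modulus \<rho>2"
    and est2: "\<And>x v. x \<in> U2 \<Longrightarrow> v \<in> restrictive_graphical_derivative H x (xbar - x) \<Longrightarrow>
             norm (H x - H xbar + v) \<le> \<rho>2 (norm (x - xbar))"
    using H2 by metis
  have "0 < C * c / 2" using C \<open>0 < c\<close> by simp
  note small = little_o_modulus_eventually_le[OF \<rho>1 this, of xbar]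
    little_o_modulus_eventually_le[OF \<rho>2 this, of xbar]
  have "((\<lambda>x. xbar - x) \<longlongrightarrow> xbar - xbar) (nhds xbar)"
    by (intro tendsto_intros filterlim_ident)
  then have "\<forall>\<^sub>F x in nhds xbar. xbar - x \<in> interior V"
    using topological_tendstoD[OF _ open_interior, of _ "xbar - xbar"] nbhd1(2) by simp
  moreover have "\<forall>\<^sub>F x in nhds xbar. x \<in> interior U1" "\<forall>\<^sub>F x in nhds xbar. x \<in> interior U2"
    using nbhd1(1) nbhd2 by (simp_all add: eventually_nhds_in_open)
  ultimately show ?thesis using small
  proof eventually_elim
    case (elim x)
    have mem: "x \<in> U1" "x \<in> U2" "xbar - x \<in> V"
      using elim interior_subset by blast+
    show ?case
    proof (intro allI impI)
      fix y assume "newton_step H x y"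
      then obtain d where d: "- H x \<in> graphical_derivative H x d" and y: "y = x + d"
        by (auto simp: newton_step_def newton_direction_def)
      obtain w where w: "w \<in> restrictive_graphical_derivative H x (xbar - x)"
        and "C * norm (d - (xbar - x)) \<le> norm (w + H x) + \<rho>1 (norm (x - xbar))"
        using est1[OF mem(1,3) d] by blast
      moreover have "norm (w + H x) \<le> \<rho>2 (norm (x - xbar))"
        using est2[OF mem(2) w] \<open>H xbar = 0\<close> by (simp add: add.commute)
      moreover have "d - (xbar - x) = y - xbar" by (simp add: y)
      ultimately have "C * norm (y - xbar) \<le> C * (c * norm (x - xbar))"
        using elim(4,5) by simp
      then show "norm (y - xbar) \<le> c * norm (x - xbar)"
        using C by simp
    qed
  qed
qed

theorem theorem3p3:
  fixes H :: "real ^ 'n \<Rightarrow> real ^ 'n" and xbar :: "real ^ 'n"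
  assumes "continuous_on UNIV H"
    and "H xbar = 0"
    and "metrically_regular_around H xbar"
    and H1: "\<exists>C>0. \<exists>U V \<rho>. xbar \<in> interior U \<and> 0 \<in> interior V \<and> little_o_modulus \<rho> \<and>
          (\<forall>x\<in>U. \<forall>z\<in>V. \<forall>d. - H x \<in> graphical_derivative H x d \<longrightarrow>
             (\<exists>w \<in> restrictive_graphical_derivative H x z.
                C * norm (d - z) \<le> norm (w + H x) + \<rho> (norm (x - xbar))))"
    and H2: "\<exists>U \<rho>. xbar \<in> interior U \<and> little_o_modulus \<rho> \<and>
          (\<forall>x\<in>U. \<forall>v \<in> restrictive_graphical_derivative H x (xbar - x).
             norm (H x - H xbar + v) \<le> \<rho> (norm (x - xbar)))"
  shows "\<exists>\<epsilon>>0. \<forall>x0 \<in> cball xbar \<epsilon>.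
           newton_well_defined H x0 \<and>
           (\<forall>x. newton_sequence H x0 x \<longrightarrow>
              x \<longlonglongrightarrow> xbar \<and>
              (\<lambda>k. norm (x (Suc k) - xbar)) \<in> o(\<lambda>k. norm (x k - xbar)))"
proof -
  have "isCont H xbar"
    using \<open>continuous_on UNIV H\<close> by (simp add: continuous_on_eq_continuous_at)
  note solvable = metrically_regular_imp_graphical_derivative_surj[OF assms(3) this]
  note contract = newton_step_error_small[OF \<open>H xbar = 0\<close> H1 H2]
  have "\<forall>\<^sub>F x in nhds xbar. (\<exists>d. newton_direction H x d) \<and>
      (\<forall>y. newton_step H x y \<longrightarrow> norm (y - xbar) \<le> 1 / 2 * norm (x - xbar))"
    using solvable contract[of "1 / 2", simplified]
    by eventually_elim (simp add: newton_direction_def)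
  then obtain \<epsilon> where "\<epsilon> > 0"
    and "\<And>x. dist x xbar \<le> \<epsilon> \<Longrightarrow> (\<exists>d. newton_direction H x d) \<and>
      (\<forall>y. newton_step H x y \<longrightarrow> norm (y - xbar) \<le> 1 / 2 * norm (x - xbar))"
    unfolding eventually_nhds_metric_le by blast
  then have direction: "\<And>x. norm (x - xbar) \<le> \<epsilon> \<Longrightarrow> \<exists>d. newton_direction H x d"
    and half: "\<And>x y. norm (x - xbar) \<le> \<epsilon> \<Longrightarrow> newton_step H x y \<Longrightarrow>
      norm (y - xbar) \<le> 1 / 2 * norm (x - xbar)"
    by (auto simp: dist_norm)
  show ?thesis
  proof (intro exI[of _ \<epsilon>] conjI ballI allI impI)
    show "\<epsilon> > 0" by fact
  next
    fix x0 assume x0: "x0 \<in> cball xbar \<epsilon>"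
    then have near: "norm (x0 - xbar) \<le> \<epsilon>"
      by (simp add: dist_norm norm_minus_commute)
    show "newton_well_defined H x0"
      unfolding newton_well_defined_def
    proof (intro allI impI)
      fix x assume "(newton_step H)\<^sup>*\<^sup>* x0 x"
      then have "norm (x - xbar) \<le> \<epsilon>"
      proof (induction rule: rtranclp_induct)
        case (step y z)
        then show ?case using half[of y z] norm_ge_zero[of "y - xbar"] by linarith
      qed (rule near)
      then show "\<exists>d. newton_direction H x d" by (rule direction)
    qed
    fix x assume "newton_sequence H x0 x"
    then have init: "x 0 = x0" and step: "\<And>k. newton_step H (x k) (x (Suc k))"
      by (auto simp: newton_sequence_def)
    have decay: "norm (x k - xbar) \<le> (1 / 2) ^ k * \<epsilon>" for k
    proof (induction k)
      case (Suc k)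
      have "(1 / 2) ^ k * \<epsilon> \<le> 1 * \<epsilon>"
        using \<open>\<epsilon> > 0\<close> by (intro mult_right_mono) (auto simp: power_le_one)
      then show ?case using half[OF _ step[of k]] Suc by simp
    qed (use init near in simp)
    have "(\<lambda>k. (1 / 2) ^ k * \<epsilon>) \<longlonglongrightarrow> 0 * \<epsilon>"
      by (intro tendsto_intros LIMSEQ_power_zero) simp
    then have "(\<lambda>k. (1 / 2) ^ k * \<epsilon>) \<longlonglongrightarrow> 0"
      by simp
    then have "(\<lambda>k. x k - xbar) \<longlonglongrightarrow> 0"
      by (rule Lim_null_comparison[rotated]) (simp add: decay always_eventually)
    then show lim: "x \<longlonglongrightarrow> xbar" by (simp add: LIM_zero_iff)
    show "(\<lambda>k. norm (x (Suc k) - xbar)) \<in> o(\<lambda>k. norm (x k - xbar))"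
    proof (rule landau_o.smallI)
      fix c :: real assume "c > 0"
      from eventually_compose_filterlim[OF contract[OF this] lim]
      show "\<forall>\<^sub>F k in sequentially.
          norm (norm (x (Suc k) - xbar)) \<le> c * norm (norm (x k - xbar))"
        by eventually_elim (use step in simp)
    qed
  qed
qed

end
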